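(* Consider the plant, the steady-state optimization problem and the standing assumptions (S1)–(S3), (J1)–(J2) described in the context. Define $$C:=\frac{(1-\rho_f)L_{f,u}+G_u^fL_{f,x}}{(1-\rho_f)^2}(1+L_h),\qquad C_1:=L_hL_{J,y}+G_y^JC,\qquad C_2:=L_{J,u}+L_hL_{J,y},$$ and, for a step size $\alpha>0$, $$M:=\begin{bmatrix}\sqrt{1-2\alpha\mu_J+\alpha^2L_{J,u}^2}+\alpha C_1 & \alpha C_2\\ G_u^f & \rho_f\end{bmatrix}.$$ Suppose $\alpha>0$ is chosen such that the spectral radius of $M$ satisfies $\rho(M)<1$. Let $\hat x_0\in\mathbb{R}^n$, $\hat u_0\in\mathcal{U}$, and let $(\hat u_k)_{k\in\mathbb{N}}$ be generated by the sequential feedback optimization algorithm: for $k=0,1,2,\dots$ $$\hat y_k=\hat x_k+w_2,$$ $$\hat u_{k+1}=\mathrm{proj}_{\mathcal{U}}\Big(\hat u_k-\alpha\big(\nabla_uJ(\hat u_k,\hat y_k)+\widetilde{\nabla h}(\hat x_k,\hat u_k)^{\top}\nabla_yJ(\hat u_k,\hat y_k)\big)\Big),$$ $$\hat x_{k+1}=f(\hat x_k,\hat u_k)+w_1 .$$ Let $(\bar u^*,\bar y^* )$ be the optimal steady state, i.e. the optimal solution of the steady-state optimization problem. Then $(\hat u_k)$ converges to a neighborhood of $\bar u^*$, with the steady-state error bounded as $$\limsup_{k\to\infty}\|\hat u_k-\bar u^*\|\le\frac{\alpha^2\,C\,L_h\,(G_u^J+L_hG_y^J)}{(1-\rho_f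)(1-\rho(M))}.$$
   Context: Plant: $x^+=f(x,u)+w_1$, $y=g(x,u)+w_2$ with state $x\in\mathbb{R}^n$, input $u\in\mathcal{U}\subseteq\mathbb{R}^p$, output $y\in\mathbb{R}^m$, and unknown disturbance vectors $w=(w_1,w_2)$ (constant in time). The output map is $g(x,u)=x$ (so $m=n$). $\mathcal{U}$ is convex and compact, $f:\mathbb{R}^n\times\mathbb{R}^p\to\mathbb{R}^n$ is continuously differentiable, and $I-\nabla_xf(x,u)$ is invertible for all $x,u$ ($\nabla_xf,\nabla_uf$ denote the partial Jacobian matrices). The steady-state map $\phi$ satisfies $\phi(u,w_1)=f(\phi(u,w_1),u)+w_1$ for all $u\in\mathcal{U}$, and the steady-state input-output map is $h(u)=h(u,w):=g(\phi(u,w_1),u)+w_2=\phi(u,w_1)+w_2$. All norms are Euclidean norms and induced matrix norms; $\mathrm{proj}_{\mathcal{U}}$ is Euclidean projection onto $\mathcal{U}$; $\rho(\cdot)$ of a matrix is its spectral radius. Assumptions on the system: (S1) $\sup_{(x,u)\in\mathbb{R}^n\times\mathcal{U}}\|\nabla_xf(x,u)\|\le\rho_f$ for some $\rho_f\in(0,1)$. (S2) $\nabla_xf$ and $\nabla_uf$ are uniformly bounded, with $\|\nabla_uf(x,u)\|\le G_u^f$, and for all $x_1,x_2\in\mathbb{R}^n$, $u_1,u_2\in\mathcal{U}$: $\|\nabla_xf(x_1,u_1)-\nabla_xf(x_2,u_2)\|\le L_{f,x}(\|x_1-x_2\|+\|u_1-u_2\|)$ and $\|\nabla_uf(x_1,u_1)-\nabla_uf(x_2,u_2)\|\le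 L_{f,u}(\|x_1-x_2\|+\|u_1-u_2\|)$. (S3) $\|h(u_1)-h(u_2)\|\le L_h\|u_1-u_2\|$ for all $u_1,u_2\in\mathcal{U}$. Assumptions on the cost $J:\mathcal{U}\times\mathbb{R}^m\to\mathbb{R}$ (with partial gradients $\nabla_uJ,\nabla_yJ$): (J1) There are constants $G_u^J,G_y^J,L_{J,u},L_{J,y}>0$ such that for all $u_1,u_2\in\mathcal{U}$, $y_1,y_2\in\mathbb{R}^m$: $\|\nabla_uJ(u_1,y_1)\|\le G_u^J$, $\|\nabla_yJ(u_1,y_1)\|\le G_y^J$, $\|\nabla_uJ(u_1,y_1)-\nabla_uJ(u_2,y_2)\|\le L_{J,u}(\|u_1-u_2\|+\|y_1-y_2\|)$, $\|\nabla_yJ(u_1,y_1)-\nabla_yJ(u_2,y_2)\|\le L_{J,y}(\|u_1-u_2\|+\|y_1-y_2\|)$. (J2) There is $\mu_J>0$ such that for every $y\in\mathbb{R}^m$ and all $u_1,u_2\in\mathcal{U}$: $(\nabla_uJ(u_1,y)-\nabla_uJ(u_2,y))^{\top}(u_1-u_2)\ge\mu_J\|u_1-u_2\|^2$. Steady-state optimization problem: minimize $J(\bar u,\bar y)$ over $(\bar u,\bar y)$ subject to $\bar y=h(\bar u,w)$, $\bar u\in\mathcal{U}$. Its optimal solution $(\bar u^*,\bar y^* )$ is called the optimal steady state. Approximate sensitivity (for $g(x,u)=x$): $\widetilde{\nabla h}(x,u):=(I-\nabla_xf(x,u))^{-1}\nabla_uf(x,u)$. *)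

theory Defs
  imports "HOL-Analysis.Analysis" "Jordan_Normal_Form.Spectral_Radius"
begin

(* Both imports provide constants called mat and vec: the identity matrix of type
   real^'n^'n is therefore written with a qualified name, and inner is used in prefix form. *)

definition continuously_differentiable ::
    "('a::real_normed_vector \<Rightarrow> 'b::real_normed_vector) \<Rightarrow> bool" where
  "continuously_differentiable F \<longleftrightarrow>
     (\<exists>F'. (\<forall>z. (F has_derivative blinfun_apply (F' z)) (at z)) \<and> continuous_on UNIV F')"

definition matrix_norm :: "real^'a^'b \<Rightarrow> real" where
  "matrix_norm A = onorm (\<lambda>v. A *v v)"

definition jac_x :: "(real^'n \<Rightarrow> real^'p \<Rightarrow> real^'n) \<Rightarrow> real^'n \<Rightarrow> real^'p \<Rightarrow> real^'n^'n" where
  "jac_x f x u = jacobian (\<lambda>x'. f x' u) (at x)"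

definition jac_u :: "(real^'n \<Rightarrow> real^'p \<Rightarrow> real^'n) \<Rightarrow> real^'n \<Rightarrow> real^'p \<Rightarrow> real^'p^'n" where
  "jac_u f x u = jacobian (\<lambda>u'. f x u') (at u)"

definition id_minus_jac_x ::
    "(real^'n \<Rightarrow> real^'p \<Rightarrow> real^'n) \<Rightarrow> real^'n \<Rightarrow> real^'p \<Rightarrow> real^'n^'n" where
  "id_minus_jac_x f x u = Finite_Cartesian_Product.mat 1 - jac_x f x u"

definition approx_sensitivity ::
    "(real^'n \<Rightarrow> real^'p \<Rightarrow> real^'n) \<Rightarrow> real^'n \<Rightarrow> real^'p \<Rightarrow> real^'p^'n" where
  "approx_sensitivity f x u = matrix_inv (id_minus_jac_x f x u) ** jac_u f x u"

(* Ju and Jy are the partial gradients of J on U \<times> UNIV. As J is only given on U in its first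
   argument, the derivative in u is taken within U. If U has empty interior, Ju is not determined
   by J, and any vector field representing the derivative along U is admitted. *)
definition partial_gradients ::
    "(real^'p) set \<Rightarrow> (real^'p \<Rightarrow> real^'m \<Rightarrow> real) \<Rightarrow>
     (real^'p \<Rightarrow> real^'m \<Rightarrow> real^'p) \<Rightarrow> (real^'p \<Rightarrow> real^'m \<Rightarrow> real^'m) \<Rightarrow> bool" where
  "partial_gradients U J Ju Jy \<longleftrightarrow>
     (\<forall>u\<in>U. \<forall>y.
        ((\<lambda>u'. J u' y) has_derivative (\<lambda>d. inner (Ju u y) d)) (at u within U) \<and>
        ((\<lambda>y'. J u y') has_derivative (\<lambda>d. inner (Jy u y) d)) (at y))"

(* The output map is g(x,u) = x. *)
definition steady_io ::
    "(real^'p \<Rightarrow> real^'n \<Rightarrow> real^'n) \<Rightarrow> real^'n \<Rightarrow> real^'n \<Rightarrow> real^'p \<Rightarrow> real^'n" where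
  "steady_io \<phi> w1 w2 u = \<phi> u w1 + w2"

definition optimal_steady_state ::
    "(real^'p) set \<Rightarrow> (real^'p \<Rightarrow> real^'m \<Rightarrow> real) \<Rightarrow> (real^'p \<Rightarrow> real^'m) \<Rightarrow>
     real^'p \<Rightarrow> real^'m \<Rightarrow> bool" where
  "optimal_steady_state U J h us ys \<longleftrightarrow>
     is_arg_min (\<lambda>(u, y). J u y) (\<lambda>(u, y). u \<in> U \<and> y = h u) (us, ys)"

definition real_spectral_radius :: "real mat \<Rightarrow> real" where
  "real_spectral_radius A = spectral_radius (map_mat complex_of_real A)"

end

theory Submission
  imports Defs
begin

text \<open>
  Replacing \<open>J\<close> by \<open>c * J\<close> and \<open>\<alpha>\<close> by \<open>\<alpha> / c\<close> changes neither the iterates nor the matrix \<open>M\<close>,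
  but divides the asserted error bound by \<open>c\<close>. Letting \<open>c\<close> grow, the bound can hold for every
  problem only if the iterates converge to the optimal input exactly. This is what is
  proved: \<open>u k \<longlonglongrightarrow> us\<close>, so that the limit superior is \<open>0\<close>, which lies below the nonnegative
  bound.

  Let \<open>xs\<close> be the steady state of \<open>us\<close>, let \<open>A\<close>, \<open>B\<close> be the Jacobians of \<open>f\<close> and \<open>S\<close> the approximate
  sensitivity, and track \<open>e k = norm (u k - us)\<close> and \<open>q k = norm (x k - xs)\<close>. The plant is Lipschitz,
  so \<open>q (k + 1) \<le> Guf * e k + \<rho>f * q k\<close> (\<open>plant_lipschitz\<close>). For the input, the sensitivity at
  \<open>(xs, us)\<close> is the exact derivative of the steady-state map (\<open>has_derivative_steady_state\<close>), so
  optimality of \<open>us\<close> says that the vector which the algorithm uses at \<open>(us, xs)\<close> makes a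
  nonnegative angle with all directions into \<open>U\<close>. The projection inequality then bounds
  \<open>d = u (k + 1) - us\<close> by the difference of the vectors used at step \<open>k\<close> and at the optimum, tested
  against \<open>d\<close> only (\<open>projected_step_error\<close>). As \<open>d\<close> points from \<open>us\<close> to a point of \<open>U\<close>, every
  sensitivity estimate is needed in such directions only; there \<open>norm (S *v d) \<le> Lh * norm d\<close> at the
  optimum, whether or not \<open>U\<close> has interior points.

  What makes the condition on \<open>M\<close> sufficient is an estimate of the change of \<open>S\<close> along \<open>d\<close>. The
  identity \<open>S *v d = A *v (S *v d) + B *v d\<close> reduces it to the changes of \<open>A\<close> and \<open>B\<close>
  (\<open>sensitivity_difference_bound\<close>). The change of \<open>B\<close> with the state has the two Lipschitz
  constants \<open>Lfu\<close> and, because mixed second differences of \<open>f\<close> are symmetric, also \<open>Lfx\<close>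
  (\<open>jac_u_difference_bound\<close>); and \<open>Lh\<close> may be replaced by \<open>min Lh (Guf / (1 - \<rho>f))\<close>. With both
  improvements the pair \<open>(e, q)\<close> obeys a linear recursion with first row \<open>(a, b)\<close>, where \<open>b\<close> can
  exceed the corresponding entry of \<open>M\<close>, while \<open>a\<close> is smaller than its counterpart by enough for
  \<open>b * Guf < (1 - a) * (1 - \<rho>f)\<close> to be inherited from \<open>M\<close> (\<open>gain_comparison\<close>). For \<open>M\<close> itself this
  inequality is a consequence of its spectral radius being below one
  (\<open>spectral_radius_less_1_2x2\<close>), and it forces \<open>e\<close> to tend to zero
  (\<open>coupled_linear_recursion_tendsto_0\<close>).
\<close>

section \<open>Partial Jacobians and the sensitivity\<close>

lemma norm_matrix_vector_le: "norm (A *v v) \<le> matrix_norm A * norm v"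
  unfolding matrix_norm_def by (rule onorm[OF matrix_vector_mul_bounded_linear])

lemma matrix_norm_nonneg: "0 \<le> matrix_norm A"
  unfolding matrix_norm_def by (rule onorm_pos_le[OF matrix_vector_mul_bounded_linear])

text \<open>
  For \<open>\<rho> < 1\<close> this says that the inverse of \<open>I - A\<close> has norm at most \<open>1 / (1 - \<rho>)\<close>; in this form
  it needs no inverse.
\<close>

lemma norm_le_resolvent:
  fixes A :: "real^'n^'n"
  assumes "matrix_norm A \<le> \<rho>"
  shows "(1 - \<rho>) * norm v \<le> norm (v - A *v v)"
proof -
  have "norm (A *v v) \<le> \<rho> * norm v"
    using norm_matrix_vector_le[of A v] mult_right_mono[OF assms norm_ge_zero[of v]] by linarith
  then show ?thesis
    using norm_triangle_ineq2[of v "A *v v"] by (simp add: algebra_simps)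
qed

lemma
  assumes "continuously_differentiable (\<lambda>(x, u). f x u)"
  shows has_derivative_jac_x: "((\<lambda>x'. f x' u) has_derivative (\<lambda>a. jac_x f x u *v a)) (at x)"
    and has_derivative_jac_u: "(f x has_derivative (\<lambda>b. jac_u f x u *v b)) (at u)"
    and has_derivative_jac:
      "((\<lambda>(x, u). f x u) has_derivative (\<lambda>(a, b). jac_x f x u *v a + jac_u f x u *v b)) (at (x, u))"
proof -
  obtain D where D: "((\<lambda>(x, u). f x u) has_derivative D) (at (x, u))"
    using assms unfolding continuously_differentiable_def by blast
  have x: "((\<lambda>x'. f x' u) has_derivative (\<lambda>a. D (a, 0))) (at x)"
  proof -
    have "((\<lambda>x'. (x', u)) has_derivative (\<lambda>a. (a, 0))) (at x)"
      by (intro has_derivative_Pair has_derivative_ident has_derivative_const)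
    from has_derivative_compose[OF this D] show ?thesis
      by simp
  qed
  have u: "(f x has_derivative (\<lambda>b. D (0, b))) (at u)"
  proof -
    have "((\<lambda>u'. (x, u')) has_derivative (\<lambda>b. (0, b))) (at u)"
      by (intro has_derivative_Pair has_derivative_ident has_derivative_const)
    from has_derivative_compose[OF this D] show ?thesis
      by simp
  qed
  show x': "((\<lambda>x'. f x' u) has_derivative (\<lambda>a. jac_x f x u *v a)) (at x)"
    unfolding jac_x_def using x jacobian_works differentiableI by blast
  show u': "(f x has_derivative (\<lambda>b. jac_u f x u *v b)) (at u)"
    unfolding jac_u_def using u jacobian_works[of "f x"] differentiableI by (metis eta_contract_eq)
  have "D (a, b) = jac_x f x u *v a + jac_u f x u *v b" for a b
  proof -
    have "D (a, b) = D (a, 0) + D (0, b)"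
      using linear_add[OF has_derivative_linear[OF D], of "(a, 0)" "(0, b)"] by simp
    then show ?thesis
      using has_derivative_unique[OF x x'] has_derivative_unique[OF u u'] by metis
  qed
  then have "D = (\<lambda>(a, b). jac_x f x u *v a + jac_u f x u *v b)"
    by auto
  then show "((\<lambda>(x, u). f x u) has_derivative (\<lambda>(a, b). jac_x f x u *v a + jac_u f x u *v b)) (at (x, u))"
    using D by simp
qed

text \<open>
  The only property of the sensitivity that is used later: it solves the linearised steady-state
  equation, which spares all computations with the inverse matrix.
\<close>

lemma approx_sensitivity_fixed_point:
  assumes "invertible (id_minus_jac_x f x u)"
  shows "approx_sensitivity f x u *v d = jac_x f x u *v (approx_sensitivity f x u *v d) + jac_u f x u *v d"
proof -
  let ?R = "id_minus_jac_x f x u"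
  have "?R ** matrix_inv ?R = Finite_Cartesian_Product.mat 1"
    using assms unfolding invertible_def matrix_inv_def by (metis (mono_tags, lifting) someI_ex)
  then have "?R *v (approx_sensitivity f x u *v d) = jac_u f x u *v d"
    unfolding approx_sensitivity_def by (simp add: matrix_vector_mul_assoc matrix_mul_assoc)
  then show ?thesis
    unfolding id_minus_jac_x_def by (simp add: matrix_vector_mult_diff_rdistrib algebra_simps)
qed

section \<open>Derivatives along directions into a convex set\<close>

text \<open>
  A derivative within \<open>U\<close> carries information only along directions \<open>b - a\<close> that point into \<open>U\<close>. The
  consequences drawn from it below concern such directions alone, so \<open>U\<close> may be
  lower-dimensional and \<open>a\<close> may lie on its boundary.
\<close>

lemma directional_quotient_tendsto:
  fixes g :: "'a::real_normed_vector \<Rightarrow> 'b::real_normed_vector"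
  assumes "convex U" "a \<in> U" "b \<in> U" "(g has_derivative g') (at a within U)"
  shows "((\<lambda>t. (g (a + t *\<^sub>R (b - a)) - g a) /\<^sub>R t) \<longlongrightarrow> g' (b - a)) (at_right 0)"
proof -
  let ?p = "\<lambda>t::real. a + t *\<^sub>R (b - a)"
  have "?p ` {0..1} \<subseteq> U"
    using assms(1-3) by (auto simp: convex_alt algebra_simps)
  then have "(g has_derivative g') (at (?p 0) within ?p ` {0..1})"
    using assms(4) has_derivative_subset by auto
  moreover have "(?p has_derivative (\<lambda>t. t *\<^sub>R (b - a))) (at 0 within {0..1})"
    by (auto intro!: derivative_eq_intros)
  ultimately have "((\<lambda>t. g (?p t)) has_derivative (\<lambda>t. g' (t *\<^sub>R (b - a)))) (at 0 within {0..1})"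
    using has_derivative_in_compose by blast
  then have "((\<lambda>t. (1 / norm (t - 0)) *\<^sub>R (g (?p t) - (g (?p 0) + g' ((t - 0) *\<^sub>R (b - a))))) \<longlongrightarrow> 0)
      (at 0 within {0..1})"
    unfolding has_derivative_within by blast
  then have "((\<lambda>t. (1 / norm (t - 0)) *\<^sub>R (g (?p t) - (g (?p 0) + g' ((t - 0) *\<^sub>R (b - a))))) \<longlongrightarrow> 0)
      (at_right 0)"
    by (simp add: at_within_Icc_at_right)
  moreover have "(1 / norm (t - 0)) *\<^sub>R (g (?p t) - (g (?p 0) + g' ((t - 0) *\<^sub>R (b - a))))
      = (g (?p t) - g a) /\<^sub>R t - g' (b - a)" if "0 < t" for t
    unfolding diff_zero linear_scale[OF has_derivative_linear[OF assms(4)]]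
    using that by (simp add: scaleR_right_diff_distrib scaleR_add_right divide_inverse)
  then have "\<forall>\<^sub>F t in at_right 0. (1 / norm (t - 0)) *\<^sub>R (g (?p t) - (g (?p 0) + g' ((t - 0) *\<^sub>R (b - a))))
      = (g (?p t) - g a) /\<^sub>R t - g' (b - a)"
    unfolding eventually_at_right_field by (intro exI[of _ 1]) auto
  ultimately show ?thesis
    using LIM_zero_cancel tendsto_cong by fastforce
qed

lemma lipschitz_directional_derivative_bound:
  fixes g :: "'a::real_normed_vector \<Rightarrow> 'b::real_normed_vector"
  assumes "convex U" "a \<in> U" "b \<in> U" "(g has_derivative g') (at a within U)"
    and lip: "\<And>v. v \<in> U \<Longrightarrow> norm (g v - g a) \<le> L * norm (v - a)"
  shows "norm (g' (b - a)) \<le> L * norm (b - a)"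
proof (rule tendsto_upperbound[OF tendsto_norm[OF directional_quotient_tendsto[OF assms(1-4)]]])
  have "norm ((g (a + t *\<^sub>R (b - a)) - g a) /\<^sub>R t) \<le> L * norm (b - a)" if "0 < t" "t < 1" for t
  proof -
    have "a + t *\<^sub>R (b - a) \<in> U"
      using assms(1-3) that convexD_alt[of U a b t] by (simp add: algebra_simps)
    from lip[OF this] that have "norm (g (a + t *\<^sub>R (b - a)) - g a) \<le> (L * norm (b - a)) * t"
      by (simp add: ac_simps)
    then have "norm (g (a + t *\<^sub>R (b - a)) - g a) / t \<le> L * norm (b - a)"
      using that by (simp add: pos_divide_le_eq)
    moreover have "norm ((g (a + t *\<^sub>R (b - a)) - g a) /\<^sub>R t) = norm (g (a + t *\<^sub>R (b - a)) - g a) / t"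
      using that unfolding norm_scaleR by (simp add: divide_inverse mult.commute)
    ultimately show ?thesis
      by linarith
  qed
  then show "\<forall>\<^sub>F t in at_right 0. norm ((g (a + t *\<^sub>R (b - a)) - g a) /\<^sub>R t) \<le> L * norm (b - a)"
    unfolding eventually_at_right_field by (intro exI[of _ 1]) auto
qed simp

lemma minimizer_directional_derivative_nonneg:
  fixes g :: "'a::real_normed_vector \<Rightarrow> real"
  assumes "convex U" "a \<in> U" "b \<in> U" "(g has_derivative g') (at a within U)"
    and min: "\<And>v. v \<in> U \<Longrightarrow> g a \<le> g v"
  shows "0 \<le> g' (b - a)"
proof (rule tendsto_lowerbound[OF directional_quotient_tendsto[OF assms(1-4)]])
  have "0 \<le> (g (a + t *\<^sub>R (b - a)) - g a) /\<^sub>R t" if "0 < t" "t < 1" for t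
  proof -
    have "a + t *\<^sub>R (b - a) \<in> U"
      using assms(1-3) that convexD_alt[of U a b t] by (simp add: algebra_simps)
    from min[OF this] that show ?thesis
      by simp
  qed
  then show "\<forall>\<^sub>F t in at_right 0. 0 \<le> (g (a + t *\<^sub>R (b - a)) - g a) /\<^sub>R t"
    unfolding eventually_at_right_field by (intro exI[of _ 1]) auto
qed simp

section \<open>First-order behaviour of the steady state and of the cost\<close>

text \<open>
  Subtracting the linearised equation from the steady-state equation at a nearby input \<open>y\<close>, the
  remainder \<open>r = \<psi> y - \<psi> a - S *v (y - a)\<close> satisfies \<open>r - A *v r = o(norm (\<psi> y - \<psi> a) + norm (y - a))\<close>.
  Since \<open>\<psi>\<close> is Lipschitz this is \<open>o(norm (y - a))\<close>, and the contraction bound carries it over to \<open>r\<close>.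
\<close>

lemma has_derivative_steady_state:
  fixes f :: "real^'n \<Rightarrow> real^'p \<Rightarrow> real^'n" and \<psi> :: "real^'p \<Rightarrow> real^'n"
  assumes C1: "continuously_differentiable (\<lambda>(x, u). f x u)"
    and fix_pt: "\<And>u. u \<in> U \<Longrightarrow> \<psi> u = f (\<psi> u) u + w"
    and lip: "L-lipschitz_on U \<psi>"
    and a: "a \<in> U" "invertible (id_minus_jac_x f (\<psi> a) a)"
    and contr: "matrix_norm (jac_x f (\<psi> a) a) \<le> \<rho>" "\<rho> < 1"
  shows "(\<psi> has_derivative (\<lambda>d. approx_sensitivity f (\<psi> a) a *v d)) (at a within U)"
  unfolding has_derivative_within_alt
proof (intro conjI allI impI)
  let ?A = "jac_x f (\<psi> a) a" and ?B = "jac_u f (\<psi> a) a" and ?S = "approx_sensitivity f (\<psi> a) a"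
  show "bounded_linear (\<lambda>d. ?S *v d)"
    by (rule matrix_vector_mul_bounded_linear)
  have L: "0 \<le> L"
    using lip by (rule lipschitz_on_nonneg)
  fix e :: real assume "0 < e"
  define e' where "e' = (1 - \<rho>) * e / (L + 1)"
  have "0 < e'"
    using \<open>0 < e\<close> contr(2) L by (simp add: e'_def)
  then obtain \<delta> where "0 < \<delta>" and \<delta>:
    "\<And>z. norm (z - (\<psi> a, a)) < \<delta> \<Longrightarrow> norm ((\<lambda>(x, u). f x u) z - f (\<psi> a) a
        - (\<lambda>(a, b). ?A *v a + ?B *v b) (z - (\<psi> a, a))) \<le> e' * norm (z - (\<psi> a, a))"
    using has_derivative_jac[OF C1, of "\<psi> a" a] unfolding has_derivative_within_alt by fastforce
  show "\<exists>d>0. \<forall>y\<in>U. norm (y - a) < d \<longrightarrow>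
      norm (\<psi> y - \<psi> a - ?S *v (y - a)) \<le> e * norm (y - a)"
  proof (intro exI[of _ "\<delta> / (L + 1)"] conjI ballI impI)
    show "0 < \<delta> / (L + 1)"
      using \<open>0 < \<delta>\<close> L by simp
    fix y assume y: "y \<in> U" "norm (y - a) < \<delta> / (L + 1)"
    let ?z = "(\<psi> y, y)" and ?r = "\<psi> y - \<psi> a - ?S *v (y - a)"
    have "norm (?z - (\<psi> a, a)) \<le> norm (\<psi> y - \<psi> a) + norm (y - a)"
      using norm_Pair_le[of "\<psi> y - \<psi> a" "y - a"] by simp
    also have "\<dots> \<le> (L + 1) * norm (y - a)"
      using lipschitz_onD[OF lip y(1) a(1)] by (simp add: dist_norm algebra_simps)
    finally have z: "norm (?z - (\<psi> a, a)) \<le> (L + 1) * norm (y - a)" .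
    then have "norm (?z - (\<psi> a, a)) < \<delta>"
      using y(2) L by (simp add: field_simps)
    from \<delta>[OF this] have "norm (f (\<psi> y) y - f (\<psi> a) a - (?A *v (\<psi> y - \<psi> a) + ?B *v (y - a)))
        \<le> e' * norm (?z - (\<psi> a, a))"
      by simp
    also have "\<dots> \<le> (1 - \<rho>) * (e * norm (y - a))"
      using mult_left_mono[OF z, of e'] \<open>0 < e'\<close> L by (simp add: e'_def)
    also have "f (\<psi> y) y - f (\<psi> a) a - (?A *v (\<psi> y - \<psi> a) + ?B *v (y - a)) = ?r - ?A *v ?r"
    proof -
      have "f (\<psi> y) y - f (\<psi> a) a = \<psi> y - \<psi> a"
        using fix_pt[OF y(1)] fix_pt[OF a(1)] by (metis add_diff_cancel_right)
      then show ?thesis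
        using approx_sensitivity_fixed_point[OF a(2), of "y - a"]
        by (simp add: matrix_vector_mult_diff_distrib algebra_simps)
    qed
    finally have "(1 - \<rho>) * norm ?r \<le> (1 - \<rho>) * (e * norm (y - a))"
      using norm_le_resolvent[OF contr(1), of ?r] by linarith
    then show "norm ?r \<le> e * norm (y - a)"
      using contr(2) by simp
  qed
qed

text \<open>
  Chain rule for a function known to have partial derivatives only: continuity of one of them, here
  \<open>Jy\<close>, makes \<open>J\<close> jointly differentiable.
\<close>

lemma has_derivative_cost_along_curve:
  fixes J :: "real^'p \<Rightarrow> real^'m \<Rightarrow> real"
  assumes grad: "partial_gradients U J Ju Jy"
    and lip: "\<And>u1 u2 y1 y2. u1 \<in> U \<Longrightarrow> u2 \<in> U \<Longrightarrow>
        norm (Jy u1 y1 - Jy u2 y2) \<le> L * (norm (u1 - u2) + norm (y1 - y2))"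
    and a: "a \<in> U" and h: "(h has_derivative h') (at a within U)"
  shows "((\<lambda>u. J u (h u)) has_derivative (\<lambda>d. inner (Ju a (h a)) d + inner (Jy a (h a)) (h' d)))
    (at a within U)"
proof -
  have "((\<lambda>z. case z of (u, y) \<Rightarrow> Jy u y) \<longlongrightarrow> Jy a (h a)) (at (a, h a) within U \<times> UNIV)"
  proof (rule LIM_zero_cancel, rule Lim_null_comparison)
    show "\<forall>\<^sub>F z in at (a, h a) within U \<times> UNIV. norm ((case z of (u, y) \<Rightarrow> Jy u y) - Jy a (h a))
        \<le> L * (norm (fst z - a) + norm (snd z - h a))"
      unfolding eventually_at_filter using lip a by (intro always_eventually) auto
    have "((\<lambda>z. L * (norm (fst z - a) + norm (snd z - h a))) \<longlongrightarrow> L * (norm (fst (a, h a) - a) + norm (snd (a, h a) - h a)))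
        (at (a, h a) within U \<times> UNIV)"
      by (intro tendsto_intros)
    then show "((\<lambda>z. L * (norm (fst z - a) + norm (snd z - h a))) \<longlongrightarrow> 0) (at (a, h a) within U \<times> UNIV)"
      by simp
  qed
  then have cont: "continuous (at (a, h a) within U \<times> UNIV) (\<lambda>(u, y). blinfun_inner_right (Jy u y))"
    unfolding continuous_within split_def by (auto intro!: tendsto_intros)
  have "((\<lambda>(u, y). J u y) has_derivative
      (\<lambda>(b, c). inner (Ju a (h a)) b + blinfun_inner_right (Jy a (h a)) c)) (at (a, h a) within U \<times> UNIV)"
    using grad a unfolding partial_gradients_def
    by (intro has_derivative_partialsI[OF _ _ cont]) auto
  then have "((\<lambda>(u, y). J u y) has_derivative
      (\<lambda>(b, c). inner (Ju a (h a)) b + inner (Jy a (h a)) c)) (at (a, h a) within (\<lambda>u. (u, h u)) ` U)"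
    by (auto intro: has_derivative_subset)
  from has_derivative_in_compose[OF has_derivative_Pair[OF has_derivative_ident h] this] show ?thesis
    by simp
qed

section \<open>Lipschitz estimates for the plant and its sensitivity\<close>

lemma mixed_difference_bound:
  fixes f :: "real^'n \<Rightarrow> real^'p \<Rightarrow> real^'n"
  assumes C1: "continuously_differentiable (\<lambda>(x, u). f x u)"
    and lip: "\<And>x. matrix_norm (jac_x f x u1 - jac_x f x u2) \<le> K"
  shows "norm ((f x1 u1 - f x1 u2) - (f x2 u1 - f x2 u2)) \<le> K * norm (x1 - x2)"
proof (rule differentiable_bound[where S = UNIV and f = "\<lambda>x. f x u1 - f x u2"])
  show "((\<lambda>x. f x u1 - f x u2) has_derivative (\<lambda>a. (jac_x f x u1 - jac_x f x u2) *v a)) (at x)" for x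
    unfolding matrix_vector_mult_diff_rdistrib
    by (intro has_derivative_diff has_derivative_jac_x[OF C1])
  show "onorm (\<lambda>a. (jac_x f x u1 - jac_x f x u2) *v a) \<le> K" for x
    using lip unfolding matrix_norm_def .
qed auto

text \<open>
  The Lipschitz constant of \<open>jac_x\<close> in the input also controls how \<open>jac_u\<close> varies with the state:
  this is the symmetry of second derivatives, for a function that need not have any. The mixed
  second difference is bounded by \<open>K * norm (x1 - x2) * norm (u1 - u2)\<close>, and dividing by the length of
  the input increment passes to the derivative along \<open>b - a\<close>.
\<close>

lemma jac_u_difference_bound:
  fixes f :: "real^'n \<Rightarrow> real^'p \<Rightarrow> real^'n"
  assumes C1: "continuously_differentiable (\<lambda>(x, u). f x u)"
    and lip: "\<And>x u1 u2. u1 \<in> U \<Longrightarrow> u2 \<in> U \<Longrightarrow> matrix_norm (jac_x f x u1 - jac_x f x u2) \<le> K * norm (u1 - u2)"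
    and U: "convex U" "a \<in> U" "b \<in> U"
  shows "norm ((jac_u f x1 a - jac_u f x2 a) *v (b - a)) \<le> K * norm (x1 - x2) * norm (b - a)"
proof (rule lipschitz_directional_derivative_bound[OF U, where g = "\<lambda>u. f x1 u - f x2 u"])
  show "((\<lambda>u. f x1 u - f x2 u) has_derivative (\<lambda>d. (jac_u f x1 a - jac_u f x2 a) *v d)) (at a within U)"
    unfolding matrix_vector_mult_diff_rdistrib
    by (intro has_derivative_diff has_derivative_at_withinI[OF has_derivative_jac_u[OF C1]])
  fix v assume "v \<in> U"
  show "norm (f x1 v - f x2 v - (f x1 a - f x2 a)) \<le> K * norm (x1 - x2) * norm (v - a)"
    using mixed_difference_bound[OF C1 lip[OF \<open>v \<in> U\<close> U(2)], of x1 x2]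
    by (simp add: algebra_simps)
qed

lemma plant_lipschitz:
  fixes f :: "real^'n \<Rightarrow> real^'p \<Rightarrow> real^'n"
  assumes C1: "continuously_differentiable (\<lambda>(x, u). f x u)" and "convex U" "u1 \<in> U" "u2 \<in> U"
    and "\<And>x u. u \<in> U \<Longrightarrow> matrix_norm (jac_x f x u) \<le> \<rho>"
    and "\<And>x u. u \<in> U \<Longrightarrow> matrix_norm (jac_u f x u) \<le> G"
  shows "norm (f x1 u1 - f x2 u2) \<le> \<rho> * norm (x1 - x2) + G * norm (u1 - u2)"
proof -
  have "norm (f x1 u1 - f x2 u1) \<le> \<rho> * norm (x1 - x2)"
    using assms(3,5) unfolding matrix_norm_def
    by (intro differentiable_bound[where S = UNIV and f = "\<lambda>x. f x u1", OF _ has_derivative_jac_x[OF C1]]) auto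
  moreover have "norm (f x2 u1 - f x2 u2) \<le> G * norm (u1 - u2)"
    using assms(2-4,6) unfolding matrix_norm_def
    by (intro differentiable_bound[where f = "f x2", OF _ has_derivative_at_withinI[OF has_derivative_jac_u[OF C1]]]) auto
  moreover have "norm (f x1 u1 - f x2 u2) \<le> norm (f x1 u1 - f x2 u1) + norm (f x2 u1 - f x2 u2)"
    using norm_triangle_ineq[of "f x1 u1 - f x2 u1" "f x2 u1 - f x2 u2"] by simp
  ultimately show ?thesis
    by linarith
qed

text \<open>
  Subtracting the two fixed-point equations gives an equation \<open>r - A *v r = \<dots>\<close> for the difference
  \<open>r\<close> of the sensitivities along \<open>d\<close>. The sensitivity that remains on the right is the second one, so that a bound
  special to the point \<open>(x2, u2)\<close> can be applied to it.
\<close>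

lemma sensitivity_difference_bound:
  assumes "invertible (id_minus_jac_x f x1 u1)" "invertible (id_minus_jac_x f x2 u2)"
    and "matrix_norm (jac_x f x1 u1) \<le> \<rho>"
  shows "(1 - \<rho>) * norm (approx_sensitivity f x1 u1 *v d - approx_sensitivity f x2 u2 *v d)
    \<le> norm (jac_u f x1 u1 *v d - jac_u f x2 u2 *v d)
      + norm ((jac_x f x1 u1 - jac_x f x2 u2) *v (approx_sensitivity f x2 u2 *v d))"
proof -
  let ?r = "approx_sensitivity f x1 u1 *v d - approx_sensitivity f x2 u2 *v d"
  have "?r - jac_x f x1 u1 *v ?r = (jac_u f x1 u1 *v d - jac_u f x2 u2 *v d)
      + (jac_x f x1 u1 - jac_x f x2 u2) *v (approx_sensitivity f x2 u2 *v d)"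
    using approx_sensitivity_fixed_point[OF assms(1), of d] approx_sensitivity_fixed_point[OF assms(2), of d]
    by (simp add: matrix_vector_mult_diff_distrib matrix_vector_mult_diff_rdistrib algebra_simps)
  then have "norm (?r - jac_x f x1 u1 *v ?r) \<le> norm (jac_u f x1 u1 *v d - jac_u f x2 u2 *v d)
      + norm ((jac_x f x1 u1 - jac_x f x2 u2) *v (approx_sensitivity f x2 u2 *v d))"
    by (simp only: norm_triangle_ineq)
  with norm_le_resolvent[OF assms(3)] show ?thesis
    by (rule order_trans)
qed

section \<open>One step of the projected gradient method\<close>

lemma norm_monotone_gradient_step_le:
  fixes d g :: "'a::real_inner"
  assumes "\<mu> * (norm d)\<^sup>2 \<le> inner g d" "norm g \<le> L * norm d" "0 \<le> \<alpha>"
  shows "norm (d - \<alpha> *\<^sub>R g) \<le> sqrt (1 - 2 * \<alpha> * \<mu> + \<alpha>\<^sup>2 * L\<^sup>2) * norm d"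
proof -
  have "(norm (d - \<alpha> *\<^sub>R g))\<^sup>2 = (norm d)\<^sup>2 - 2 * \<alpha> * inner g d + \<alpha>\<^sup>2 * (norm g)\<^sup>2"
    by (simp only: power2_norm_eq_inner)
      (simp add: inner_diff_left inner_diff_right inner_commute power2_eq_square algebra_simps)
  also have "\<dots> \<le> (norm d)\<^sup>2 - 2 * \<alpha> * (\<mu> * (norm d)\<^sup>2) + \<alpha>\<^sup>2 * (L * norm d)\<^sup>2"
  proof -
    have "2 * \<alpha> * (\<mu> * (norm d)\<^sup>2) \<le> 2 * \<alpha> * inner g d"
      using assms(1,3) by (intro mult_left_mono) auto
    moreover have "\<alpha>\<^sup>2 * (norm g)\<^sup>2 \<le> \<alpha>\<^sup>2 * (L * norm d)\<^sup>2"
      using assms(2) by (intro mult_left_mono power_mono) auto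
    ultimately show ?thesis
      by linarith
  qed
  also have "\<dots> = (1 - 2 * \<alpha> * \<mu> + \<alpha>\<^sup>2 * L\<^sup>2) * (norm d)\<^sup>2"
    by (simp add: power2_eq_square algebra_simps)
  finally have "sqrt ((norm (d - \<alpha> *\<^sub>R g))\<^sup>2) \<le> sqrt ((1 - 2 * \<alpha> * \<mu> + \<alpha>\<^sup>2 * L\<^sup>2) * (norm d)\<^sup>2)"
    by (rule real_sqrt_le_mono)
  \<comment> \<open>The radicand may be negative when \<open>d = 0\<close>; \<open>sqrt\<close> is odd and multiplicative on all reals.\<close>
  then show ?thesis
    by (simp only: real_sqrt_mult real_sqrt_abs abs_norm_cancel)
qed

text \<open>
  Sum of two variational inequalities, the one for the projection tested with \<open>us\<close> and the one for
  \<open>us\<close> tested with the projected point. Only the component of \<open>g - gs\<close> along \<open>p - us\<close> enters, which is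
  more precise than nonexpansiveness of the projection.
\<close>

lemma projected_step_error:
  fixes v g gs us :: "'a::euclidean_space"
  assumes "convex U" "closed U" "us \<in> U" "0 \<le> \<alpha>"
    and VI: "\<And>p. p \<in> U \<Longrightarrow> 0 \<le> inner gs (p - us)"
  defines "p \<equiv> closest_point U (v - \<alpha> *\<^sub>R g)"
  shows "(norm (p - us))\<^sup>2 \<le> inner (v - us - \<alpha> *\<^sub>R (g - gs)) (p - us)"
proof -
  have "p \<in> U"
    using assms(2,3) unfolding p_def by (intro closest_point_in_set) auto
  then have "0 \<le> \<alpha> * inner gs (p - us)"
    using VI assms(4) by simp
  moreover have "inner (v - \<alpha> *\<^sub>R g - p) (us - p) \<le> 0"
    unfolding p_def using assms(1-3) by (rule closest_point_dot)
  ultimately show ?thesis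
    unfolding power2_norm_eq_inner
    by (simp add: inner_diff_left inner_diff_right inner_commute algebra_simps)
qed

section \<open>Two-dimensional linear recursions\<close>

text \<open>
  The off-diagonal product is nonnegative, so the larger root \<open>(a + d + s) / 2\<close> of the characteristic
  polynomial is real; being an eigenvalue it is below one, and squaring \<open>s < 2 - a - d\<close> gives the
  claim. The eigenvector \<open>(b, ev - a)\<close> is nonzero because \<open>b > 0\<close>.
\<close>

lemma spectral_radius_less_1_2x2:
  fixes a b c d :: real
  assumes M: "M = mat_of_rows_list 2 [[a, b], [c, d]]" and "0 < b" "0 \<le> c"
    and rad: "real_spectral_radius M < 1"
  shows "b * c < (1 - a) * (1 - d)"
proof -
  define s where "s = sqrt ((a - d)\<^sup>2 + 4 * (b * c))"
  define ev where "ev = (a + d + s) / 2"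
  have ev: "ev + ev = a + d + s"
    unfolding ev_def by (rule field_sum_of_halves)
  let ?N = "map_mat complex_of_real M"
  let ?v = "vec_of_list [complex_of_real b, complex_of_real (ev - a)]"
  have bc: "0 \<le> b * c"
    using assms by simp
  then have rad_nonneg: "0 \<le> (a - d)\<^sup>2 + 4 * (b * c)"
    by simp
  have s_sq: "s\<^sup>2 = (a - d)\<^sup>2 + 4 * (b * c)"
    unfolding s_def by (rule real_sqrt_pow2[OF rad_nonneg])
  moreover have "s = 2 * ev - a - d"
    using ev by simp
  moreover have "4 * (ev * (ev - a) - (c * b + d * (ev - a))) = (2 * ev - a - d)\<^sup>2 - ((a - d)\<^sup>2 + 4 * (b * c))"
    by (simp add: power2_eq_square algebra_simps)
  ultimately have root: "c * b + d * (ev - a) = ev * (ev - a)"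
    by simp
  have N: "?N \<in> carrier_mat 2 2"
    unfolding M mat_of_rows_list_def by (rule carrier_matI) simp_all
  have entries: "?N = Matrix.mat 2 2 (\<lambda>(i, j). complex_of_real ([[a, b], [c, d]] ! i ! j))"
    unfolding M mat_of_rows_list_def by (rule eq_matI) simp_all
  have "?N *\<^sub>v ?v = complex_of_real ev \<cdot>\<^sub>v ?v"
  proof (rule eq_vecI)
    fix i assume "i < dim_vec (complex_of_real ev \<cdot>\<^sub>v ?v)"
    then consider "i = 0" | "i = 1"
      by fastforce
    then show "(?N *\<^sub>v ?v) $ i = (complex_of_real ev \<cdot>\<^sub>v ?v) $ i"
    proof cases
      case 1
      then show ?thesis
        by (simp add: entries scalar_prod_def sum.atLeast0_lessThan_Suc eval_nat_numeral algebra_simps)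
    next
      case 2
      then show ?thesis
        using arg_cong[OF root, of complex_of_real]
        by (simp add: entries scalar_prod_def sum.atLeast0_lessThan_Suc eval_nat_numeral)
    qed
  qed (simp add: entries)
  moreover have carrier: "dim_row ?N = 2" "?v \<in> carrier_vec 2"
    using N by (auto intro: carrier_vecI)
  moreover have "?v \<noteq> 0\<^sub>v 2"
  proof
    assume "?v = 0\<^sub>v 2"
    then have "?v $ 0 = 0\<^sub>v 2 $ 0"
      by (rule arg_cong)
    then show False
      using \<open>0 < b\<close> by simp
  qed
  ultimately have "eigenvector ?N ?v (complex_of_real ev)"
    using carrier unfolding eigenvector_def by simp
  then have "complex_of_real ev \<in> spectrum ?N"
    unfolding spectrum_def eigenvalue_def by blast
  then have "ev < 1"
    using spectral_radius_mem_max(2)[OF N _ imageI] rad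
    unfolding real_spectral_radius_def by fastforce
  then have "s < 2 - a - d"
    using ev by linarith
  then have "s\<^sup>2 < (2 - a - d)\<^sup>2"
    by (rule power_strict_mono) (simp_all add: s_def rad_nonneg)
  moreover have "(2 - a - d)\<^sup>2 - (a - d)\<^sup>2 = 4 * ((1 - a) * (1 - d))"
    by (simp add: power2_eq_square algebra_simps)
  ultimately show ?thesis
    using s_sq by linarith
qed

text \<open>
  The weighted sum \<open>e + t * q\<close> contracts if \<open>b / (1 - d) < t\<close> and \<open>t * c < 1 - a\<close>; the last hypothesis
  says exactly that \<open>b / (1 - d)\<close> satisfies the second of these strictly, which leaves room for \<open>t\<close>.
\<close>

lemma coupled_linear_recursion_tendsto_0:
  fixes e q :: "nat \<Rightarrow> real"
  assumes e: "\<And>k. e (Suc k) \<le> a * e k + b * q k" "\<And>k. 0 \<le> e k"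
    and q: "\<And>k. q (Suc k) \<le> c * e k + d * q k" "\<And>k. 0 \<le> q k"
    and "0 \<le> b" "0 \<le> c" "d < 1" "b * c < (1 - a) * (1 - d)"
  shows "e \<longlonglongrightarrow> 0"
proof -
  obtain t where t: "0 < t" "b < t * (1 - d)" "t * c < 1 - a"
  proof -
    define \<epsilon> where "\<epsilon> = ((1 - a) * (1 - d) - b * c) / (2 * (c + 1))"
    have "0 < \<epsilon>"
      using assms by (simp add: \<epsilon>_def)
    have "\<epsilon> * c < (1 - a) * (1 - d) - b * c"
    proof -
      have "\<epsilon> * (2 * (c + 1)) = (1 - a) * (1 - d) - b * c"
        using assms by (simp add: \<epsilon>_def)
      moreover have "\<epsilon> * c < \<epsilon> * (2 * (c + 1))"
        using \<open>0 < \<epsilon>\<close> \<open>0 \<le> c\<close> by simp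
      ultimately show ?thesis
        by simp
    qed
    then have "(b + \<epsilon>) / (1 - d) * c < 1 - a"
      using \<open>d < 1\<close> by (simp add: field_simps)
    then show thesis
      using \<open>0 < \<epsilon>\<close> \<open>0 \<le> b\<close> \<open>d < 1\<close> by (intro that[of "(b + \<epsilon>) / (1 - d)"]) auto
  qed
  define r where "r = max 0 (max (a + t * c) (b / t + d))"
  have "b / t + d < 1"
    using t(1,2) by (simp add: field_simps)
  then have r: "0 \<le> r" "r < 1" "a + t * c \<le> r" "b / t + d \<le> r"
    using t(3) by (auto simp: r_def)
  have r': "b + t * d \<le> t * r"
    using mult_left_mono[OF r(4), of t] t(1) by (simp add: distrib_left)
  define W where "W k = e k + t * q k" for k
  have "W (Suc k) \<le> r * W k" for k
  proof -
    have "W (Suc k) \<le> (a * e k + b * q k) + t * (c * e k + d * q k)"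
      using e(1)[of k] mult_left_mono[OF q(1)[of k], of t] t(1) unfolding W_def by linarith
    also have "\<dots> = (a + t * c) * e k + (b + t * d) * q k"
      by (simp add: algebra_simps)
    also have "\<dots> \<le> r * e k + (t * r) * q k"
      using r(3) r' e(2) q(2) by (intro add_mono mult_right_mono) auto
    finally show ?thesis
      by (simp add: W_def algebra_simps)
  qed
  then have "W k \<le> r ^ k * W 0" for k
  proof (induction k)
    case (Suc k)
    then show ?case
      using mult_left_mono[OF Suc.IH[OF Suc.prems] r(1)] order_trans by fastforce
  qed simp
  moreover have "e k \<le> W k" for k
    using q(2) t(1) by (simp add: W_def)
  ultimately have "\<forall>\<^sub>F k in sequentially. norm (e k) \<le> r ^ k * W 0"
    using e(2) order_trans by (intro always_eventually) fastforce
  moreover have "(\<lambda>k. r ^ k * W 0) \<longlonglongrightarrow> 0"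
    using tendsto_mult_left_zero[OF LIMSEQ_realpow_zero[OF r(1,2)]] .
  ultimately show ?thesis
    by (rule Lim_null_comparison)
qed

text \<open>
  For \<open>\<gamma> = Guf / (1 - \<rho>f)\<close>, a nonnegative matrix with rows \<open>(a, b)\<close> and \<open>(Guf, \<rho>f)\<close>, where \<open>\<rho>f < 1\<close>, is
  stable when \<open>a + b * \<gamma> < 1\<close>. The two sides are \<open>a + b * \<gamma>\<close> for the error recursion and for the
  matrix of the theorem, without the common summand in \<open>a\<close> and the common factor \<open>\<alpha>\<close>.

  At \<open>Lh = l\<close> the right-hand side exceeds the left-hand side by
  \<open>\<kappa> * (\<gamma> * Lfx + Lfu * l - Lfx * l - \<gamma> * min Lfu Lfx)\<close>. This is \<open>\<kappa> * (Lfu - Lfx) * l\<close> if \<open>Lfx \<le> Lfu\<close>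
  and \<open>\<kappa> * (Lfx - Lfu) * (\<gamma> - l)\<close> otherwise: the first case needs the minimum, the
  second \<open>l \<le> \<gamma>\<close>. The right-hand side increases with \<open>Lh\<close>.
\<close>

lemma gain_comparison:
  fixes Lh :: real
  assumes "0 \<le> l" "l \<le> Lh" "l \<le> \<gamma>" "0 \<le> Lfx" "0 \<le> Lfu" "0 \<le> LJy" "0 \<le> \<kappa>"
  shows "l * LJy + \<kappa> * (Lfu + Lfx * l) + (LJu + l * LJy + \<kappa> * (min Lfu Lfx + Lfx * l)) * \<gamma>
    \<le> Lh * LJy + \<kappa> * ((Lfu + \<gamma> * Lfx) * (1 + Lh)) + (LJu + Lh * LJy) * \<gamma>"
proof -
  have "Lfx * l + min Lfu Lfx * \<gamma> \<le> \<gamma> * Lfx + Lfu * l"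
  proof (cases "Lfx \<le> Lfu")
    case True
    then show ?thesis
      using mult_right_mono[OF True assms(1)] by simp
  next
    case False
    then have "0 \<le> (Lfx - Lfu) * (\<gamma> - l)"
      using assms(3) by simp
    then show ?thesis
      using False by (simp add: algebra_simps)
  qed
  then have "Lfu + Lfx * l + (min Lfu Lfx + Lfx * l) * \<gamma> \<le> (Lfu + \<gamma> * Lfx) * (1 + l)"
    by (simp add: algebra_simps)
  also have "\<dots> \<le> (Lfu + \<gamma> * Lfx) * (1 + Lh)"
    using assms by (intro mult_left_mono) auto
  finally have "\<kappa> * (Lfu + Lfx * l + (min Lfu Lfx + Lfx * l) * \<gamma>) \<le> \<kappa> * ((Lfu + \<gamma> * Lfx) * (1 + Lh))"
    using assms by (intro mult_left_mono)
  moreover have "(l * LJy) * (1 + \<gamma>) \<le> (Lh * LJy) * (1 + \<gamma>)"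
    using assms by (intro mult_right_mono) auto
  ultimately show ?thesis
    by (simp add: algebra_simps)
qed

section \<open>Convergence to the optimal steady state\<close>

theorem theorem1:
  fixes f :: "real^'n \<Rightarrow> real^'p \<Rightarrow> real^'n"
    and U :: "(real^'p) set"
    and \<phi> :: "real^'p \<Rightarrow> real^'n \<Rightarrow> real^'n"
    and w1 w2 :: "real^'n"
    and h :: "real^'p \<Rightarrow> real^'n"
    and J :: "real^'p \<Rightarrow> real^'n \<Rightarrow> real"
    and Ju :: "real^'p \<Rightarrow> real^'n \<Rightarrow> real^'p"
    and Jy :: "real^'p \<Rightarrow> real^'n \<Rightarrow> real^'n"
    and \<rho>f Guf Lfx Lfu Lh GuJ GyJ LJu LJy \<mu>J \<alpha> C C1 C2 :: real
    and M :: "real mat"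
    and x y :: "nat \<Rightarrow> real^'n" and u :: "nat \<Rightarrow> real^'p"
    and us :: "real^'p" and ys :: "real^'n"
  assumes U: "convex U" "compact U"
    and f_C1: "continuously_differentiable (\<lambda>(x, u). f x u)"
    and inv: "\<forall>x. \<forall>u\<in>U. invertible (id_minus_jac_x f x u)"
    and phi: "\<forall>u\<in>U. \<phi> u w1 = f (\<phi> u w1) u + w1"
    and h: "h = steady_io \<phi> w1 w2"
    and S1: "0 < \<rho>f" "\<rho>f < 1"
        "\<forall>x. \<forall>u\<in>U. matrix_norm (jac_x f x u) \<le> \<rho>f"
    and S2: "\<forall>x. \<forall>u\<in>U. matrix_norm (jac_u f x u) \<le> Guf"
        "\<forall>x1 x2. \<forall>u1\<in>U. \<forall>u2\<in>U. matrix_norm (jac_x f x1 u1 - jac_x f x2 u2)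
           \<le> Lfx * (norm (x1 - x2) + norm (u1 - u2))"
        "\<forall>x1 x2. \<forall>u1\<in>U. \<forall>u2\<in>U. matrix_norm (jac_u f x1 u1 - jac_u f x2 u2)
           \<le> Lfu * (norm (x1 - x2) + norm (u1 - u2))"
    and S3: "Lh-lipschitz_on U h"
    and J_grad: "partial_gradients U J Ju Jy"
    and J1_pos: "0 < GuJ" "0 < GyJ" "0 < LJu" "0 < LJy"
    and J1: "\<forall>u\<in>U. \<forall>y. norm (Ju u y) \<le> GuJ"
        "\<forall>u\<in>U. \<forall>y. norm (Jy u y) \<le> GyJ"
        "\<forall>u1\<in>U. \<forall>u2\<in>U. \<forall>y1 y2. norm (Ju u1 y1 - Ju u2 y2)
           \<le> LJu * (norm (u1 - u2) + norm (y1 - y2))"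
        "\<forall>u1\<in>U. \<forall>u2\<in>U. \<forall>y1 y2. norm (Jy u1 y1 - Jy u2 y2)
           \<le> LJy * (norm (u1 - u2) + norm (y1 - y2))"
    and J2: "0 < \<mu>J"
        "\<forall>y. \<forall>u1\<in>U. \<forall>u2\<in>U. inner (Ju u1 y - Ju u2 y) (u1 - u2) \<ge> \<mu>J * (norm (u1 - u2))\<^sup>2"
    and C: "C = ((1 - \<rho>f) * Lfu + Guf * Lfx) / (1 - \<rho>f)\<^sup>2 * (1 + Lh)"
    and C1: "C1 = Lh * LJy + GyJ * C"
    and C2: "C2 = LJu + Lh * LJy"
    and M: "M = mat_of_rows_list 2
        [[sqrt (1 - 2 * \<alpha> * \<mu>J + \<alpha>\<^sup>2 * LJu\<^sup>2) + \<alpha> * C1, \<alpha> * C2],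
         [Guf, \<rho>f]]"
    and alpha: "0 < \<alpha>" "real_spectral_radius M < 1"
    and u0: "u 0 \<in> U"
    and y_k: "\<forall>k. y k = x k + w2"
    and u_k: "\<forall>k. u (Suc k) = closest_point U
        (u k - \<alpha> *\<^sub>R (Ju (u k) (y k)
                    + transpose (approx_sensitivity f (x k) (u k)) *v Jy (u k) (y k)))"
    and x_k: "\<forall>k. x (Suc k) = f (x k) (u k) + w1"
    and opt: "optimal_steady_state U J h us ys"
  shows "limsup (\<lambda>k. ereal (norm (u k - us)))
    \<le> ereal (\<alpha>\<^sup>2 * C * Lh * (GuJ + Lh * GyJ) / ((1 - \<rho>f) * (1 - real_spectral_radius M)))"
proof -
  define xs where "xs = \<phi> us w1"
  define \<gamma> where "\<gamma> = Guf / (1 - \<rho>f)"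
  define l where "l = min Lh \<gamma>"
  define \<kappa> where "\<kappa> = GyJ / (1 - \<rho>f)"
  define s where "s = sqrt (1 - 2 * \<alpha> * \<mu>J + \<alpha>\<^sup>2 * LJu\<^sup>2)"
  \<comment> \<open>\<open>a\<close> and \<open>b\<close> are the first row of the recursion that \<open>(e, q)\<close> will be shown to satisfy.\<close>
  define a where "a = s + \<alpha> * (l * LJy + \<kappa> * (Lfu + Lfx * l))"
  define b where "b = \<alpha> * (LJu + l * LJy + \<kappa> * (min Lfu Lfx + Lfx * l))"
  define e where "e k = norm (u k - us)" for k
  define q where "q k = norm (x k - xs)" for k
  let ?A = "jac_x f" and ?B = "jac_u f" and ?S = "approx_sensitivity f"

  have us: "us \<in> U" "ys = xs + w2" and min: "\<And>v. v \<in> U \<Longrightarrow> J us (h us) \<le> J v (h v)"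
    using opt unfolding optimal_steady_state_def is_arg_min_def by (auto simp: h steady_io_def xs_def not_less)
  have closed: "closed U"
    using U(2) by (rule compact_imp_closed)
  have uU: "u k \<in> U" for k
  proof (cases k)
    case (Suc i)
    then show ?thesis
      using u_k closest_point_in_set[OF closed] us(1) by auto
  qed (simp add: u0)

  have signs: "0 \<le> Lh" "0 \<le> Guf" "0 \<le> Lfx" "0 \<le> Lfu" "0 < 1 - \<rho>f" "0 \<le> \<kappa>"
  proof -
    show "0 \<le> Lh"
      using S3 by (rule lipschitz_on_nonneg)
    show "0 \<le> Guf"
      using S2(1) us(1) matrix_norm_nonneg order_trans by blast
    show pos: "0 < 1 - \<rho>f"
      using S1(2) by simp
    show "0 \<le> \<kappa>"
      using pos J1_pos(2) by (simp add: \<kappa>_def)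
    \<comment> \<open>Two different states with the same input show that the Lipschitz constants are nonnegative.\<close>
    obtain v :: "real^'n" where v: "norm v = 1"
      using vector_choose_size[of 1] by auto
    have "0 \<le> Lfx * (norm (v - 0) + norm (us - us))" "0 \<le> Lfu * (norm (v - 0) + norm (us - us))"
      using S2(2,3) us(1) matrix_norm_nonneg order_trans by blast+
    then show "0 \<le> Lfx" "0 \<le> Lfu"
      using v by simp_all
  qed
  have l: "0 \<le> l" "l \<le> Lh" "l \<le> \<gamma>"
    using signs by (auto simp: l_def \<gamma>_def)

  have phi_lip: "Lh-lipschitz_on U (\<lambda>v. \<phi> v w1)"
    using S3 unfolding h steady_io_def lipschitz_on_def by simp
  have phi_deriv: "((\<lambda>v. \<phi> v w1) has_derivative (\<lambda>d. ?S xs us *v d)) (at us within U)"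
    unfolding xs_def using phi inv S1 us(1)
    by (intro has_derivative_steady_state[OF f_C1 _ phi_lip]) auto
  have h_deriv: "(h has_derivative (\<lambda>d. ?S xs us *v d)) (at us within U)"
    using has_derivative_add[OF phi_deriv has_derivative_const[of w2]]
    unfolding h steady_io_def by simp

  define gs where "gs = Ju us ys + transpose (?S xs us) *v Jy us ys"
  have VI: "0 \<le> inner gs (v - us)" if "v \<in> U" for v
  proof -
    have hus: "h us = ys"
      by (simp add: h steady_io_def us(2) xs_def)
    have "((\<lambda>v. J v (h v)) has_derivative
        (\<lambda>d. inner (Ju us (h us)) d + inner (Jy us (h us)) (?S xs us *v d))) (at us within U)"
      using J1(4) by (intro has_derivative_cost_along_curve[OF J_grad _ us(1) h_deriv]) blast
    from minimizer_directional_derivative_nonneg[OF U(1) us(1) that this min]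
    have "0 \<le> inner (Ju us (h us)) (v - us) + inner (Jy us (h us)) (?S xs us *v (v - us))"
      by simp
    then show ?thesis
      by (simp add: gs_def hus inner_add_left dot_lmul_matrix)
  qed

  have S_bound: "norm (?S xs us *v (v - us)) \<le> l * norm (v - us)" if "v \<in> U" for v
  proof -
    have "norm (?S xs us *v (v - us)) \<le> Lh * norm (v - us)"
      using lipschitz_onD[OF phi_lip _ us(1)]
      by (intro lipschitz_directional_derivative_bound[OF U(1) us(1) that phi_deriv]) (simp add: dist_norm)
    moreover have "norm (?S xs us *v (v - us)) \<le> \<gamma> * norm (v - us)"
    proof -
      let ?r = "?S xs us *v (v - us)"
      have "(1 - \<rho>f) * norm ?r \<le> norm (?r - ?A xs us *v ?r)"
        using S1(3) us(1) by (intro norm_le_resolvent) auto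
      also have "?r - ?A xs us *v ?r = ?B xs us *v (v - us)"
        using approx_sensitivity_fixed_point[of f xs us "v - us"] inv us(1)
        by (simp add: algebra_simps)
      also have "norm (?B xs us *v (v - us)) \<le> Guf * norm (v - us)"
        using norm_matrix_vector_le S2(1) us(1) by (meson mult_right_mono norm_ge_zero order_trans)
      finally show ?thesis
        using signs(5) by (simp add: \<gamma>_def pos_le_divide_eq mult.commute)
    qed
    ultimately show ?thesis
      by (simp add: l_def min_def)
  qed

  have B_bound: "norm (?B (x k) (u k) *v (v - us) - ?B xs us *v (v - us))
      \<le> (Lfu * e k + min Lfu Lfx * q k) * norm (v - us)" if "v \<in> U" for k v
  proof -
    let ?d = "v - us"
    have mat: "norm ((?B x1 u1 - ?B x2 u2) *v ?d) \<le> Lfu * (norm (x1 - x2) + norm (u1 - u2)) * norm ?d"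
      if "u1 \<in> U" "u2 \<in> U" for x1 x2 u1 u2
      using norm_matrix_vector_le S2(3) that by (meson mult_right_mono norm_ge_zero order_trans)
    \<comment> \<open>The path from \<open>(xs, us)\<close> to \<open>(x k, u k)\<close> is split at \<open>(x k, us)\<close>, so that the base point
       of the mixed-difference estimate is \<open>us\<close>, from which \<open>?d\<close> points into \<open>U\<close>.\<close>
    have "norm ((?B (x k) us - ?B xs us) *v ?d) \<le> Lfx * norm (x k - xs) * norm ?d"
      using S2(2) by (intro jac_u_difference_bound[OF f_C1 _ U(1) us(1) that])
        (metis add_0 diff_self norm_zero)
    moreover have "norm ((?B (x k) us - ?B xs us) *v ?d) \<le> Lfu * norm (x k - xs) * norm ?d"
      using mat[OF us(1) us(1), of "x k" xs] by simp
    ultimately have x_part: "norm ((?B (x k) us - ?B xs us) *v ?d) \<le> min Lfu Lfx * q k * norm ?d"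
      by (simp add: q_def min_def)
    have u_part: "norm ((?B (x k) (u k) - ?B (x k) us) *v ?d) \<le> Lfu * e k * norm ?d"
      using mat[OF uU us(1), of "x k" k "x k"] by (simp add: e_def)
    have "?B (x k) (u k) *v ?d - ?B xs us *v ?d
        = (?B (x k) (u k) - ?B (x k) us) *v ?d + (?B (x k) us - ?B xs us) *v ?d"
      by (simp add: matrix_vector_mult_diff_rdistrib)
    then have "norm (?B (x k) (u k) *v ?d - ?B xs us *v ?d)
        \<le> norm ((?B (x k) (u k) - ?B (x k) us) *v ?d) + norm ((?B (x k) us - ?B xs us) *v ?d)"
      by (simp only: norm_triangle_ineq)
    also have "\<dots> \<le> Lfu * e k * norm ?d + min Lfu Lfx * q k * norm ?d"
      by (rule add_mono[OF u_part x_part])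
    finally show ?thesis
      by (simp only: distrib_right)
  qed

  have dS_bound: "GyJ * norm (?S (x k) (u k) *v (v - us) - ?S xs us *v (v - us))
      \<le> \<kappa> * (Lfu * e k + min Lfu Lfx * q k + Lfx * l * (e k + q k)) * norm (v - us)"
    if "v \<in> U" for k v
  proof -
    let ?d = "v - us" and ?R = "Lfu * e k + min Lfu Lfx * q k + Lfx * l * (e k + q k)"
    let ?D = "norm (?S (x k) (u k) *v (v - us) - ?S xs us *v (v - us))"
    have "(1 - \<rho>f) * ?D \<le> norm (?B (x k) (u k) *v ?d - ?B xs us *v ?d)
        + norm ((?A (x k) (u k) - ?A xs us) *v (?S xs us *v ?d))"
      using inv S1(3) uU us(1) by (intro sensitivity_difference_bound) auto
    also have "norm ((?A (x k) (u k) - ?A xs us) *v (?S xs us *v ?d))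
        \<le> (Lfx * (q k + e k)) * (l * norm ?d)"
    proof -
      have "matrix_norm (?A (x k) (u k) - ?A xs us) \<le> Lfx * (q k + e k)"
        using S2(2) uU us(1) by (simp add: q_def e_def)
      moreover have "0 \<le> Lfx * (q k + e k)"
        using signs by (simp add: q_def e_def)
      ultimately have "matrix_norm (?A (x k) (u k) - ?A xs us) * norm (?S xs us *v ?d)
          \<le> (Lfx * (q k + e k)) * (l * norm ?d)"
        by (intro mult_mono S_bound[OF that] norm_ge_zero)
      then show ?thesis
        by (rule order_trans[OF norm_matrix_vector_le])
    qed
    finally have "(1 - \<rho>f) * ?D \<le> ?R * norm ?d"
      using B_bound[OF that, of k] by (simp add: algebra_simps)
    then have "?D \<le> ?R * norm ?d / (1 - \<rho>f)"
      using signs(5) by (simp add: pos_le_divide_eq mult.commute)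
    then have "GyJ * ?D \<le> GyJ * (?R * norm ?d / (1 - \<rho>f))"
      using J1_pos(2) by (intro mult_left_mono) auto
    then show ?thesis
      by (simp add: \<kappa>_def)
  qed

  have e_step: "e (Suc k) \<le> a * e k + b * q k" for k
  proof -
    let ?d = "u (Suc k) - us"
    define g where "g = Ju (u k) (y k) + transpose (?S (x k) (u k)) *v Jy (u k) (y k)"
    define dJ where "dJ = Ju (u k) (y k) - Ju us (y k)"
    define dJ' where "dJ' = Ju us (y k) - Ju us ys"
    define dy where "dy = Jy (u k) (y k) - Jy us ys"
    have yq: "norm (y k - ys) = q k"
      by (simp add: y_k us(2) q_def)
    \<comment> \<open>Strong monotonicity is available at the common output \<open>y k\<close> only, hence the intermediate
       gradient \<open>Ju us (y k)\<close>; in the second product the sensitivity at the optimum multiplies the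
       gradient difference, because \<open>S_bound\<close> holds there.\<close>
    have split: "inner (u k - us - \<alpha> *\<^sub>R (g - gs)) ?d = inner (u k - us - \<alpha> *\<^sub>R dJ) ?d
        - \<alpha> * (inner dJ' ?d + inner dy (?S xs us *v ?d)
          + inner (Jy (u k) (y k)) (?S (x k) (u k) *v ?d - ?S xs us *v ?d))"
      by (simp add: g_def gs_def dJ_def dJ'_def dy_def inner_diff_left inner_diff_right inner_add_left
          dot_lmul_matrix algebra_simps)
    have grad_lip: "norm (Ju (u k) (y k) - Ju us (y k)) \<le> LJu * norm (u k - us)"
      using J1(3) uU us(1) by (metis add.right_neutral diff_self norm_zero)
    have main: "norm (u k - us - \<alpha> *\<^sub>R dJ) \<le> s * e k"
      unfolding s_def e_def dJ_def using J2(2) J1(3) uU us(1) alpha(1)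
      by (intro norm_monotone_gradient_step_le) (use uU us(1) in \<open>auto simp: grad_lip\<close>)
    have "(norm ?d)\<^sup>2 \<le> inner (u k - us - \<alpha> *\<^sub>R (g - gs)) ?d"
      using projected_step_error[OF U(1) closed us(1) less_imp_le[OF alpha(1)] VI, of "u k" g]
        u_k unfolding g_def by simp
    also have "\<dots> \<le> norm (u k - us - \<alpha> *\<^sub>R dJ) * norm ?d
        + \<alpha> * (norm dJ' * norm ?d + norm dy * norm (?S xs us *v ?d)
          + norm (Jy (u k) (y k)) * norm (?S (x k) (u k) *v ?d - ?S xs us *v ?d))"
    proof -
      have "- (inner dJ' ?d + inner dy (?S xs us *v ?d)
          + inner (Jy (u k) (y k)) (?S (x k) (u k) *v ?d - ?S xs us *v ?d))
        \<le> norm dJ' * norm ?d + norm dy * norm (?S xs us *v ?d)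
          + norm (Jy (u k) (y k)) * norm (?S (x k) (u k) *v ?d - ?S xs us *v ?d)"
        using Cauchy_Schwarz_ineq2[of dJ' ?d] Cauchy_Schwarz_ineq2[of dy "?S xs us *v ?d"]
          Cauchy_Schwarz_ineq2[of "Jy (u k) (y k)" "?S (x k) (u k) *v ?d - ?S xs us *v ?d"] by linarith
      from mult_left_mono[OF this, of \<alpha>] alpha(1) show ?thesis
        unfolding split using norm_cauchy_schwarz[of "u k - us - \<alpha> *\<^sub>R dJ" ?d]
        by (simp only: mult_minus_right) linarith
    qed
    also have "\<dots> \<le> (s * e k) * norm ?d + \<alpha> * ((LJu * q k) * norm ?d + (LJy * (e k + q k)) * (l * norm ?d)
          + \<kappa> * (Lfu * e k + min Lfu Lfx * q k + Lfx * l * (e k + q k)) * norm ?d)"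
    proof -
      have dJ': "norm dJ' \<le> LJu * q k"
        using J1(3) us(1) unfolding dJ'_def yq[symmetric] by (metis add_0 diff_self norm_zero)
      have "norm dy \<le> LJy * (e k + q k)"
        using J1(4) uU us(1) unfolding dy_def yq[symmetric] e_def by blast
      then have dy: "norm dy * norm (?S xs us *v ?d) \<le> (LJy * (e k + q k)) * (l * norm ?d)"
        using J1_pos(4) by (intro mult_mono S_bound[OF uU]) (auto simp: e_def q_def)
      have "norm (Jy (u k) (y k)) * norm (?S (x k) (u k) *v ?d - ?S xs us *v ?d)
          \<le> GyJ * norm (?S (x k) (u k) *v ?d - ?S xs us *v ?d)"
        using J1(2) uU by (intro mult_right_mono) auto
      then have dS: "norm (Jy (u k) (y k)) * norm (?S (x k) (u k) *v ?d - ?S xs us *v ?d)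
          \<le> \<kappa> * (Lfu * e k + min Lfu Lfx * q k + Lfx * l * (e k + q k)) * norm ?d"
        using dS_bound[OF uU] by (rule order_trans)
      show ?thesis
        using alpha(1) by (intro add_mono mult_left_mono mult_right_mono[OF main]
            mult_right_mono[OF dJ'] dy dS) auto
    qed
    also have "\<dots> = (a * e k + b * q k) * norm ?d"
      by (simp add: a_def b_def algebra_simps)
    finally have *: "(norm ?d)\<^sup>2 \<le> (a * e k + b * q k) * norm ?d" .
    \<comment> \<open>Nonnegativity of the bound settles the case \<open>?d = 0\<close>, where one cannot divide.\<close>
    have "0 \<le> \<alpha> * (l * LJy + \<kappa> * (Lfu + Lfx * l)) * e k" "0 \<le> b * q k"
      using alpha(1) l(1) signs J1_pos by (simp_all add: b_def e_def q_def)
    then have "0 \<le> a * e k + b * q k"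
      using order_trans[OF norm_ge_zero main] by (simp add: a_def distrib_right)
    with * show ?thesis
      unfolding e_def by (cases "?d = 0") (simp_all add: power2_eq_square)
  qed

  have q_step: "q (Suc k) \<le> Guf * e k + \<rho>f * q k" for k
  proof -
    have "x (Suc k) - xs = f (x k) (u k) - f xs us"
      using x_k phi us(1) unfolding xs_def by (metis add_diff_cancel_right)
    then show ?thesis
      using plant_lipschitz[OF f_C1 U(1) uU us(1), of \<rho>f Guf "x k" k xs] S1(3) S2(1)
      by (simp add: q_def e_def)
  qed

  have gain: "b * Guf < (1 - a) * (1 - \<rho>f)"
  proof -
    have "0 < \<alpha> * C2"
      using alpha(1) J1_pos signs by (simp add: C2 add_pos_nonneg)
    from spectral_radius_less_1_2x2[OF M this signs(2) alpha(2)]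
    have M_gain: "(\<alpha> * C2) * Guf < (1 - (s + \<alpha> * C1)) * (1 - \<rho>f)"
      by (simp add: s_def)
    have G: "Guf = \<gamma> * (1 - \<rho>f)"
      using signs(5) by (simp add: \<gamma>_def)
    have C': "GyJ * C = \<kappa> * ((Lfu + \<gamma> * Lfx) * (1 + Lh))"
    proof -
      have "(1 - \<rho>f) * Lfu + Guf * Lfx = (1 - \<rho>f) * (Lfu + \<gamma> * Lfx)"
        unfolding G by (simp add: algebra_simps)
      then show ?thesis
        using signs(5) unfolding C \<kappa>_def by (simp add: power2_eq_square)
    qed
    have "a + b * \<gamma> \<le> (s + \<alpha> * C1) + (\<alpha> * C2) * \<gamma>"
      using mult_left_mono[OF gain_comparison[OF l signs(3,4) less_imp_le[OF J1_pos(4)] signs(6), of LJu],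
          of \<alpha>] alpha(1)
      unfolding a_def b_def C1 C2 C' by (simp add: algebra_simps)
    moreover have "(\<alpha> * C2) * \<gamma> < 1 - (s + \<alpha> * C1)"
      using M_gain signs(5) unfolding G mult.assoc[symmetric] by simp
    ultimately have "b * \<gamma> < 1 - a"
      by linarith
    then show ?thesis
      using signs(5) unfolding G mult.assoc[symmetric] by simp
  qed

  have "e \<longlonglongrightarrow> 0"
  proof (rule coupled_linear_recursion_tendsto_0[where q = q])
    show "0 \<le> e k" "0 \<le> q k" for k
      by (simp_all add: e_def q_def)
    show "0 \<le> b"
      using alpha(1) J1_pos signs l(1) by (simp add: b_def)
  qed (fact e_step q_step gain signs(2) S1(2))+
  then have "limsup (\<lambda>k. ereal (e k)) = ereal 0"
    by (intro lim_imp_Limsup) auto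
  moreover have "0 \<le> \<alpha>\<^sup>2 * C * Lh * (GuJ + Lh * GyJ) / ((1 - \<rho>f) * (1 - real_spectral_radius M))"
    using signs J1_pos alpha by (auto simp: C intro!: divide_nonneg_nonneg mult_nonneg_nonneg add_nonneg_nonneg)
  ultimately show ?thesis
    by (simp add: e_def)
qed

end
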